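(* Let $X$ be a set and let $\mathbf{R}$ be a residuated lattice whose lattice reduct is $\mathbf{M}_X$, with bottom $\bot$ and top $\top$. Put $U=\{x\in R\setminus\{\bot,\top\}: x\top=\top\}$ and $Z=\{x\in R\setminus\{\bot,\top\}: x\top=x\}$. Then: (1) $\top$ is central in $\mathbf{R}$ (that is, $x\top=\top x$ for all $x\in R$), and $R=U\sqcup Z\sqcup\{\bot,\top\}$ (disjoint union). (2) $U_\top:=U\cup\{\top\}$ is a $\top$-cancellative submonoid of $\mathbf{R}$. (3) $Z_\bot:=Z\cup\{\bot\}$ is a subsemigroup of $\mathbf{R}$ with zero $\bot$, $|Z_\bot|\le 3$, and $xy=\bot$ for all distinct $x,y\in Z_\bot$. Also, either $Z_\bot$ is idempotent (every element satisfies $x^2=x$), or $Z_\bot=\{b,\bot\}$ with $b^2=\bot$. (4) $ab=ba=b$ for all $a\in U$ and $b\in Z$.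
   Context: A residuated lattice is an algebra $(R,\wedge,\vee,\cdot,\backslash,/,1)$ such that $(R,\wedge,\vee)$ is a lattice, $(R,\cdot,1)$ is a monoid, and for all $x,y,z\in R$: $xy\le z \iff y\le x\backslash z \iff x\le z/y$. For a set $X$, $\mathbf{M}_X$ is the lattice on $X\cup\{\bot,\top\}$ ($\bot\neq\top$, neither in $X$) with top $\top$, bottom $\bot$, and $x\vee y=\top$, $x\wedge y=\bot$ for distinct $x,y\in X$. A residuated lattice is "based on $\mathbf{M}_X$" if $\mathbf{M}_X$ is its lattice reduct. A monoid $\mathbf{S}$ with a zero (absorbing element) $0$ is $0$-cancellative if for all $x,y,z\in S$: $xy=xz\neq 0$ implies $y=z$, and $yx=zx\neq 0$ implies $y=z$. So "$\top$-cancellative" means that $\top$ is the zero of the monoid and this condition holds with $0=\top$. *)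

theory Defs
  imports "HOL-Algebra.Group"
begin

section \<open>Residuated lattices\<close>

text \<open>
  The monoid part reuses the record and the locale \<^locale>\<open>monoid\<close> of HOL-Algebra.  The lattice
  operations are primitive operations of the algebra, and the order is the one they induce.
\<close>

record 'a residuated_lattice = "'a monoid" +
  rl_meet :: "['a, 'a] \<Rightarrow> 'a"
  rl_join :: "['a, 'a] \<Rightarrow> 'a"
  ldiv :: "['a, 'a] \<Rightarrow> 'a"  \<comment> \<open>\<open>ldiv R x z\<close> is \<open>x\<close> under \<open>z\<close>, the left residual\<close>
  rdiv :: "['a, 'a] \<Rightarrow> 'a"  \<comment> \<open>\<open>rdiv R z y\<close> is \<open>z\<close> over \<open>y\<close>, the right residual\<close>

definition rl_le :: "('a, 'b) residuated_lattice_scheme \<Rightarrow> 'a \<Rightarrow> 'a \<Rightarrow> bool"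
  where "rl_le R x y \<longleftrightarrow> rl_meet R x y = x"

locale residuated_lattice = monoid R for R (structure) +
  assumes rl_meet_closed: "\<lbrakk>x \<in> carrier R; y \<in> carrier R\<rbrakk> \<Longrightarrow> rl_meet R x y \<in> carrier R"
    and rl_join_closed: "\<lbrakk>x \<in> carrier R; y \<in> carrier R\<rbrakk> \<Longrightarrow> rl_join R x y \<in> carrier R"
    and ldiv_closed: "\<lbrakk>x \<in> carrier R; z \<in> carrier R\<rbrakk> \<Longrightarrow> ldiv R x z \<in> carrier R"
    and rdiv_closed: "\<lbrakk>z \<in> carrier R; y \<in> carrier R\<rbrakk> \<Longrightarrow> rdiv R z y \<in> carrier R"
    and rl_meet_comm: "\<lbrakk>x \<in> carrier R; y \<in> carrier R\<rbrakk> \<Longrightarrow> rl_meet R x y = rl_meet R y x"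
    and rl_join_comm: "\<lbrakk>x \<in> carrier R; y \<in> carrier R\<rbrakk> \<Longrightarrow> rl_join R x y = rl_join R y x"
    and rl_meet_assoc: "\<lbrakk>x \<in> carrier R; y \<in> carrier R; z \<in> carrier R\<rbrakk>
      \<Longrightarrow> rl_meet R (rl_meet R x y) z = rl_meet R x (rl_meet R y z)"
    and rl_join_assoc: "\<lbrakk>x \<in> carrier R; y \<in> carrier R; z \<in> carrier R\<rbrakk>
      \<Longrightarrow> rl_join R (rl_join R x y) z = rl_join R x (rl_join R y z)"
    and rl_meet_join_absorb: "\<lbrakk>x \<in> carrier R; y \<in> carrier R\<rbrakk> \<Longrightarrow> rl_meet R x (rl_join R x y) = x"
    and rl_join_meet_absorb: "\<lbrakk>x \<in> carrier R; y \<in> carrier R\<rbrakk> \<Longrightarrow> rl_join R x (rl_meet R x y) = x"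
    and ldiv_residual: "\<lbrakk>x \<in> carrier R; y \<in> carrier R; z \<in> carrier R\<rbrakk>
      \<Longrightarrow> rl_le R (x \<otimes> y) z \<longleftrightarrow> rl_le R y (ldiv R x z)"
    and rdiv_residual: "\<lbrakk>x \<in> carrier R; y \<in> carrier R; z \<in> carrier R\<rbrakk>
      \<Longrightarrow> rl_le R (x \<otimes> y) z \<longleftrightarrow> rl_le R x (rdiv R z y)"

text \<open>The lattice reduct is a lattice in the order-theoretic sense of HOL-Algebra.\<close>

abbreviation rl_order :: "('a, 'b) residuated_lattice_scheme \<Rightarrow> 'a gorder"
  where "rl_order R \<equiv> \<lparr>carrier = carrier R, eq = (=), le = rl_le R\<rparr>"

context residuated_lattice
begin

lemma rl_meet_idem: "x \<in> carrier R \<Longrightarrow> rl_meet R x x = x"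
  by (metis rl_join_meet_absorb rl_meet_closed rl_meet_join_absorb)

lemma rl_le_iff_join: "\<lbrakk>x \<in> carrier R; y \<in> carrier R\<rbrakk> \<Longrightarrow> rl_le R x y \<longleftrightarrow> rl_join R x y = y"
  unfolding rl_le_def
  by (metis rl_join_comm rl_join_meet_absorb rl_meet_comm rl_meet_join_absorb)

lemma partial_order_rl_order: "partial_order (rl_order R)"
  by unfold_locales (auto simp: rl_le_def rl_meet_idem rl_meet_comm, metis rl_meet_assoc)

lemma rl_meet_greatest:
  assumes "x \<in> carrier R" "y \<in> carrier R"
  shows "greatest (rl_order R) (rl_meet R x y) (Lower (rl_order R) {x, y})"
proof -
  have "rl_meet R (rl_meet R x y) x = rl_meet R x y" "rl_meet R (rl_meet R x y) y = rl_meet R x y"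
    using assms by (metis rl_meet_assoc rl_meet_comm rl_meet_idem rl_meet_closed)+
  then show ?thesis
    using assms by (auto simp: greatest_def Lower_def rl_le_def rl_meet_closed)
      (metis rl_meet_assoc)
qed

lemma rl_join_least:
  assumes "x \<in> carrier R" "y \<in> carrier R"
  shows "least (rl_order R) (rl_join R x y) (Upper (rl_order R) {x, y})"
proof -
  have "rl_le R x (rl_join R x y)" "rl_le R y (rl_join R x y)"
    using assms by (metis rl_le_def rl_meet_join_absorb rl_join_comm)+
  moreover have "rl_le R (rl_join R x y) z"
    if "z \<in> carrier R" "rl_le R x z" "rl_le R y z" for z
    using that assms by (metis rl_le_iff_join rl_join_assoc rl_join_closed)
  ultimately show ?thesis
    using assms by (auto simp: least_def Upper_def rl_join_closed)
qed

lemma lattice_rl_order: "lattice (rl_order R)"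
proof -
  interpret partial_order "rl_order R" by (rule partial_order_rl_order)
  show ?thesis
    by unfold_locales (auto intro: rl_meet_greatest rl_join_least)
qed

end


section \<open>The lattices \<open>M_X\<close>\<close>

text \<open>
  Meets and joins that involve \<open>bt\<close> or \<open>tp\<close> are determined by these being the bounds.
\<close>

definition based_on_M :: "('a, 'b) residuated_lattice_scheme \<Rightarrow> 'a set \<Rightarrow> 'a \<Rightarrow> 'a \<Rightarrow> bool"
  where "based_on_M R X bt tp \<longleftrightarrow>
    bt \<noteq> tp \<and> bt \<notin> X \<and> tp \<notin> X \<and> carrier R = X \<union> {bt, tp} \<and>
    (\<forall>x\<in>carrier R. rl_le R bt x \<and> rl_le R x tp) \<and>
    (\<forall>x\<in>X. \<forall>y\<in>X. x \<noteq> y \<longrightarrow> rl_join R x y = tp \<and> rl_meet R x y = bt)"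


section \<open>Semigroups and monoids with zero\<close>

definition subsemigroup :: "'a set \<Rightarrow> ('a, 'b) monoid_scheme \<Rightarrow> bool"
  where "subsemigroup H G \<longleftrightarrow>
    H \<subseteq> carrier G \<and> H \<noteq> {} \<and> (\<forall>x\<in>H. \<forall>y\<in>H. x \<otimes>\<^bsub>G\<^esub> y \<in> H)"

definition is_zero :: "('a, 'b) monoid_scheme \<Rightarrow> 'a \<Rightarrow> bool"
  where "is_zero S z \<longleftrightarrow>
    z \<in> carrier S \<and> (\<forall>x\<in>carrier S. z \<otimes>\<^bsub>S\<^esub> x = z \<and> x \<otimes>\<^bsub>S\<^esub> z = z)"

definition zero_cancellative :: "('a, 'b) monoid_scheme \<Rightarrow> 'a \<Rightarrow> bool"
  where "zero_cancellative S z \<longleftrightarrow> monoid S \<and> is_zero S z \<and>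
    (\<forall>x\<in>carrier S. \<forall>y\<in>carrier S. \<forall>w\<in>carrier S.
      (x \<otimes>\<^bsub>S\<^esub> y = x \<otimes>\<^bsub>S\<^esub> w \<and> x \<otimes>\<^bsub>S\<^esub> w \<noteq> z \<longrightarrow> y = w) \<and>
      (y \<otimes>\<^bsub>S\<^esub> x = w \<otimes>\<^bsub>S\<^esub> x \<and> w \<otimes>\<^bsub>S\<^esub> x \<noteq> z \<longrightarrow> y = w))"

end

theory Submission
  imports Defs
begin

text \<open>
  Multiplication in a residuated lattice preserves finite joins, in particular the empty one, so the
  bottom \<open>\<bottom>\<close> of a residuated lattice on \<open>M_X\<close> is absorbing.  Since \<open>1 \<le> \<top>\<close>,
  multiplying by \<open>\<top>\<close> is inflationary, and an atom \<open>x\<close> has only itself and \<open>\<top>\<close> above it;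
  so \<open>x\<top>\<close> is \<open>x\<close> or \<open>\<top>\<close>, which divides the atoms into \<open>Z\<close> and \<open>U\<close>.  That
  \<open>\<top>x\<close> is the same element is clear if \<open>1 = \<top>\<close> or \<open>x = 1\<close>; otherwise \<open>x\<close> and
  \<open>1\<close> are distinct atoms, and \<open>\<top> = x \<or> 1\<close> yields \<open>x\<top> = xx \<or> x = \<top>x\<close>.

  The statements on \<open>U\<close> and \<open>Z\<close> separately rest on one observation: two distinct atoms \<open>y\<close>, \<open>z\<close> have join \<open>\<top>\<close>, so
  \<open>x\<top> = xy \<or> xz\<close> for every \<open>x\<close>.
  For \<open>x \<in> U\<close> this says that \<open>xy = xz\<close> forces both to be \<open>\<top>\<close>, which is
  \<open>\<top>\<close>-cancellativity.
  For \<open>x \<in> Z\<close> it says \<open>x = xy \<or> xz\<close>, whereas a product of elements of \<open>Z\<close> lies below both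
  factors, so that products of distinct elements of \<open>Z\<close> are \<open>\<bottom>\<close>.  Three distinct elements
  \<open>x\<close>, \<open>y\<close>, \<open>z\<close> of \<open>Z\<close> would then give \<open>x = \<bottom>\<close>, and two, \<open>x\<close> and \<open>y\<close>, give
  \<open>x = xx \<or> xy = xx\<close>.
  Finally, for \<open>a \<in> U\<close> and \<open>b \<in> Z\<close> the product \<open>ab\<close> lies below \<open>\<top>b = b\<close>, and it is not
  \<open>\<bottom>\<close> because \<open>\<top>(ab) = \<top>b = b\<close>.
\<close>

section \<open>Multiplication in a residuated lattice\<close>

context residuated_lattice
begin

lemma rl_le_refl: "x \<in> carrier R \<Longrightarrow> rl_le R x x"
  by (simp add: rl_le_def rl_meet_idem)

lemma rl_le_trans:
  assumes "rl_le R x y" "rl_le R y z" "x \<in> carrier R" "y \<in> carrier R" "z \<in> carrier R"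
  shows "rl_le R x z"
  using rl_meet_assoc[of x y z] assms by (simp add: rl_le_def)

lemma rl_le_antisym:
  "\<lbrakk>rl_le R x y; rl_le R y x; x \<in> carrier R; y \<in> carrier R\<rbrakk> \<Longrightarrow> x = y"
  unfolding rl_le_def by (metis rl_meet_comm)

lemma rl_join_upper1: "\<lbrakk>x \<in> carrier R; y \<in> carrier R\<rbrakk> \<Longrightarrow> rl_le R x (rl_join R x y)"
  by (simp add: rl_le_def rl_meet_join_absorb)

lemma rl_join_upper2: "\<lbrakk>x \<in> carrier R; y \<in> carrier R\<rbrakk> \<Longrightarrow> rl_le R y (rl_join R x y)"
  by (metis rl_join_upper1 rl_join_comm)

lemma rl_join_le:
  "\<lbrakk>rl_le R x z; rl_le R y z; x \<in> carrier R; y \<in> carrier R; z \<in> carrier R\<rbrakk>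
    \<Longrightarrow> rl_le R (rl_join R x y) z"
  by (metis rl_le_iff_join rl_join_assoc rl_join_closed)

lemma rl_join_idem: "x \<in> carrier R \<Longrightarrow> rl_join R x x = x"
  using rl_le_iff_join rl_le_refl by blast

lemma mult_mono_right:
  assumes "rl_le R y z" "x \<in> carrier R" "y \<in> carrier R" "z \<in> carrier R"
  shows "rl_le R (x \<otimes> y) (x \<otimes> z)"
proof -
  have "rl_le R z (ldiv R x (x \<otimes> z))"
    using assms rl_le_refl ldiv_residual by (metis m_closed)
  then have "rl_le R y (ldiv R x (x \<otimes> z))"
    using assms rl_le_trans ldiv_closed by (metis m_closed)
  then show ?thesis using assms ldiv_residual by (metis m_closed)
qed

lemma mult_mono_left:
  assumes "rl_le R x y" "x \<in> carrier R" "y \<in> carrier R" "z \<in> carrier R"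
  shows "rl_le R (x \<otimes> z) (y \<otimes> z)"
proof -
  have "rl_le R y (rdiv R (y \<otimes> z) z)"
    using assms rl_le_refl rdiv_residual by (metis m_closed)
  then have "rl_le R x (rdiv R (y \<otimes> z) z)"
    using assms rl_le_trans rdiv_closed by (metis m_closed)
  then show ?thesis using assms rdiv_residual by (metis m_closed)
qed

text \<open>The maps \<open>y \<mapsto> xy\<close> and \<open>y \<mapsto> yx\<close> are lower adjoints, hence preserve joins.\<close>

lemma mult_rl_join_right:
  assumes "x \<in> carrier R" "y \<in> carrier R" "z \<in> carrier R"
  shows "x \<otimes> rl_join R y z = rl_join R (x \<otimes> y) (x \<otimes> z)" (is "?l = ?r")
proof (rule rl_le_antisym)
  have xy: "x \<otimes> y \<in> carrier R" and xz: "x \<otimes> z \<in> carrier R" and r: "?r \<in> carrier R"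
    using assms rl_join_closed by simp_all
  have "rl_le R y (ldiv R x ?r)" "rl_le R z (ldiv R x ?r)"
    using assms r rl_join_upper1[OF xy xz] rl_join_upper2[OF xy xz] ldiv_residual by blast+
  then have "rl_le R (rl_join R y z) (ldiv R x ?r)"
    using assms r rl_join_le ldiv_closed by blast
  then show "rl_le R ?l ?r" using assms r ldiv_residual rl_join_closed by blast
  show "rl_le R ?r ?l"
    using assms xy xz
    by (intro rl_join_le mult_mono_right rl_join_upper1 rl_join_upper2)
      (auto simp: rl_join_closed)
qed (use assms rl_join_closed in auto)

lemma mult_rl_join_left:
  assumes "x \<in> carrier R" "y \<in> carrier R" "z \<in> carrier R"
  shows "rl_join R y z \<otimes> x = rl_join R (y \<otimes> x) (z \<otimes> x)" (is "?l = ?r")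
proof (rule rl_le_antisym)
  have yx: "y \<otimes> x \<in> carrier R" and zx: "z \<otimes> x \<in> carrier R" and r: "?r \<in> carrier R"
    using assms rl_join_closed by simp_all
  have "rl_le R y (rdiv R ?r x)" "rl_le R z (rdiv R ?r x)"
    using assms r rl_join_upper1[OF yx zx] rl_join_upper2[OF yx zx] rdiv_residual by blast+
  then have "rl_le R (rl_join R y z) (rdiv R ?r x)"
    using assms r rl_join_le rdiv_closed by blast
  then show "rl_le R ?l ?r" using assms r rdiv_residual rl_join_closed by blast
  show "rl_le R ?r ?l"
    using assms yx zx
    by (intro rl_join_le mult_mono_left rl_join_upper1 rl_join_upper2)
      (auto simp: rl_join_closed)
qed (use assms rl_join_closed in auto)

end

section \<open>Products with the top element\<close>

locale residuated_lattice_on_M = residuated_lattice R for R (structure) +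
  fixes X :: "'a set" and bt tp :: 'a
  assumes based: "based_on_M R X bt tp"
begin

lemma bt_ne_tp: "bt \<noteq> tp"
  and bt_notin: "bt \<notin> X"
  and tp_notin: "tp \<notin> X"
  and carrier_eq: "carrier R = X \<union> {bt, tp}"
  using based by (auto simp: based_on_M_def)

lemma bt_closed [simp]: "bt \<in> carrier R"
  and tp_closed [simp]: "tp \<in> carrier R"
  and atom_closed: "x \<in> X \<Longrightarrow> x \<in> carrier R"
  by (auto simp: carrier_eq)

lemma bt_le: "x \<in> carrier R \<Longrightarrow> rl_le R bt x"
  and le_tp: "x \<in> carrier R \<Longrightarrow> rl_le R x tp"
  and join_atoms: "\<lbrakk>x \<in> X; y \<in> X; x \<noteq> y\<rbrakk> \<Longrightarrow> rl_join R x y = tp"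
  using based by (auto simp: based_on_M_def)

lemma le_atomD:
  assumes "rl_le R y x" "x \<in> X" "y \<in> carrier R"
  shows "y = x \<or> y = bt"
proof -
  have "y \<noteq> tp"
    using assms rl_le_antisym le_tp tp_notin atom_closed tp_closed by metis
  then consider "y = bt" | "y \<in> X" using assms carrier_eq by blast
  then show ?thesis
  proof cases
    case 2
    then show ?thesis
      using assms join_atoms rl_le_iff_join atom_closed tp_notin by metis
  qed simp
qed

lemma ge_atomD:
  assumes "rl_le R x y" "x \<in> X" "y \<in> carrier R"
  shows "y = x \<or> y = tp"
proof -
  consider "y = bt" | "y = tp" | "y \<in> X" using assms carrier_eq by blast
  then show ?thesis
  proof cases
    case 1
    then have "x = bt" using assms bt_le rl_le_antisym atom_closed bt_closed by metis
    then show ?thesis using assms bt_notin by simp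
  next
    case 3
    then show ?thesis using le_atomD assms atom_closed bt_notin by blast
  qed simp
qed

lemma join_bt: "x \<in> carrier R \<Longrightarrow> rl_join R x bt = x"
  using bt_le rl_le_iff_join rl_join_comm by (metis bt_closed)

text \<open>An absorbing bottom is preservation of the empty join by a lower adjoint.\<close>

lemma mult_bt: "x \<in> carrier R \<Longrightarrow> x \<otimes> bt = bt"
  by (meson bt_closed bt_le ldiv_closed ldiv_residual m_closed rl_le_antisym)

lemma bt_mult: "x \<in> carrier R \<Longrightarrow> bt \<otimes> x = bt"
  by (meson bt_closed bt_le rdiv_closed rdiv_residual m_closed rl_le_antisym)

text \<open>If \<open>\<one>\<close> were the absorbing element \<open>bt\<close>, then all elements would coincide.\<close>

lemma one_cases: "\<one> \<in> X \<or> \<one> = tp"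
proof -
  have "\<one> \<noteq> bt" using bt_mult[OF tp_closed] bt_ne_tp l_one[OF tp_closed] by auto
  then show ?thesis using one_closed carrier_eq by auto
qed

lemma le_mult_tp: "x \<in> carrier R \<Longrightarrow> rl_le R x (x \<otimes> tp)"
  using mult_mono_right[of \<one> tp x] le_tp[OF one_closed] by simp

lemma tp_mult_tp: "tp \<otimes> tp = tp"
  using le_mult_tp[of tp] le_tp[of "tp \<otimes> tp"] by (intro rl_le_antisym) auto

lemma atom_mult_tp: "x \<in> X \<Longrightarrow> x \<otimes> tp = x \<or> x \<otimes> tp = tp"
  using ge_atomD[OF le_mult_tp] atom_closed by simp

text \<open>
  For distinct atoms \<open>x\<close> and \<open>\<one>\<close> both products are \<open>xx \<or> x\<close>, because
  \<open>tp = x \<or> \<one>\<close>; in the other cases the two elements commute trivially.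
\<close>

lemma tp_central:
  assumes x: "x \<in> carrier R"
  shows "x \<otimes> tp = tp \<otimes> x"
proof -
  consider "x = bt" | "x = tp" | "\<one> = tp" | "x = \<one>" | "x \<in> X" "\<one> \<in> X" "x \<noteq> \<one>"
    using x carrier_eq one_cases by blast
  then show ?thesis
  proof cases
    case 1
    then show ?thesis by (simp add: mult_bt bt_mult)
  next
    case 3
    then show ?thesis using x by (metis l_one r_one)
  next
    case 5
    have tp: "tp = rl_join R x \<one>" using join_atoms[OF 5] by simp
    have "x \<otimes> tp = rl_join R (x \<otimes> x) x"
      using mult_rl_join_right[OF x x one_closed] x by (simp add: tp)
    moreover have "tp \<otimes> x = rl_join R (x \<otimes> x) x"
      using mult_rl_join_left[OF x x one_closed] x by (simp add: tp)
    ultimately show ?thesis by simp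
  qed simp_all
qed

section \<open>The two kinds of atoms\<close>

definition "U = {x \<in> carrier R - {bt, tp}. x \<otimes> tp = tp}"
definition "Z = {x \<in> carrier R - {bt, tp}. x \<otimes> tp = x}"

lemma U_iff: "x \<in> U \<longleftrightarrow> x \<in> X \<and> x \<otimes> tp = tp"
  using carrier_eq bt_notin tp_notin by (auto simp: U_def)

lemma Z_iff: "x \<in> Z \<longleftrightarrow> x \<in> X \<and> x \<otimes> tp = x"
  using carrier_eq bt_notin tp_notin by (auto simp: Z_def)

lemma atom_in_U_or_Z: "x \<in> X \<Longrightarrow> x \<in> U \<or> x \<in> Z"
  using atom_mult_tp U_iff Z_iff by blast

lemma carrier_decomp: "carrier R = U \<union> Z \<union> {bt, tp}"
  using atom_in_U_or_Z U_iff Z_iff carrier_eq by blast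

lemma U_Z_disjoint: "U \<inter> Z = {}"
  using U_iff Z_iff tp_notin by force

lemma Utp_closed: "x \<in> U \<union> {tp} \<Longrightarrow> x \<in> carrier R"
  and Zbt_closed: "x \<in> Z \<union> {bt} \<Longrightarrow> x \<in> carrier R"
  using carrier_decomp by auto

lemma Utp_iff: "x \<in> U \<union> {tp} \<longleftrightarrow> x \<in> carrier R \<and> x \<otimes> tp = tp"
  using carrier_eq U_iff mult_bt bt_mult bt_ne_tp tp_mult_tp by auto

lemma Utp_tp_mult: "x \<in> U \<union> {tp} \<Longrightarrow> tp \<otimes> x = tp"
  using Utp_iff tp_central by metis

lemma Zbt_mult_tp: "x \<in> Z \<union> {bt} \<Longrightarrow> x \<otimes> tp = x"
  using Z_iff bt_mult[OF tp_closed] by auto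

lemma Zbt_tp_mult: "x \<in> Z \<union> {bt} \<Longrightarrow> tp \<otimes> x = x"
  using Zbt_mult_tp tp_central Zbt_closed by metis

section \<open>Cancellation among the atoms that \<open>\<top>\<close> absorbs\<close>

lemma submonoid_Utp: "submonoid (U \<union> {tp}) R"
proof
  show "U \<union> {tp} \<subseteq> carrier R" using Utp_closed by blast
  show "\<one> \<in> U \<union> {tp}" unfolding Utp_iff by simp
  fix x y assume "x \<in> U \<union> {tp}" "y \<in> U \<union> {tp}"
  then show "x \<otimes> y \<in> U \<union> {tp}" by (simp only: Utp_iff m_assoc m_closed tp_closed simp_thms)
qed

text \<open>
  Distinct \<open>y\<close>, \<open>z\<close> with \<open>xy = xz \<noteq> tp\<close> would be atoms with join \<open>tp\<close>, and then
  \<open>x tp = xy \<or> xz\<close> would be this common product, although it is \<open>tp\<close>.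
\<close>

lemma Utp_cancel_left:
  assumes x: "x \<in> U \<union> {tp}" and y: "y \<in> U \<union> {tp}" and z: "z \<in> U \<union> {tp}"
    and eq: "x \<otimes> y = x \<otimes> z" and ne: "x \<otimes> z \<noteq> tp"
  shows "y = z"
proof (rule ccontr)
  assume "y \<noteq> z"
  moreover have "y \<noteq> tp" "z \<noteq> tp" using x eq ne unfolding Utp_iff by metis+
  then have "y \<in> X" "z \<in> X" using y z by (simp_all add: U_iff)
  ultimately have "x \<otimes> tp = rl_join R (x \<otimes> y) (x \<otimes> z)"
    using mult_rl_join_right Utp_closed x y z join_atoms by metis
  also have "\<dots> = x \<otimes> z" using eq rl_join_idem Utp_closed x z by simp
  finally show False using x ne Utp_iff by simp
qed

lemma Utp_cancel_right:
  assumes x: "x \<in> U \<union> {tp}" and y: "y \<in> U \<union> {tp}" and z: "z \<in> U \<union> {tp}"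
    and eq: "y \<otimes> x = z \<otimes> x" and ne: "z \<otimes> x \<noteq> tp"
  shows "y = z"
proof (rule ccontr)
  assume "y \<noteq> z"
  moreover have "y \<noteq> tp" "z \<noteq> tp" using Utp_tp_mult[OF x] eq ne by metis+
  then have "y \<in> X" "z \<in> X" using y z by (simp_all add: U_iff)
  ultimately have "tp \<otimes> x = rl_join R (y \<otimes> x) (z \<otimes> x)"
    using mult_rl_join_left Utp_closed x y z join_atoms by metis
  also have "\<dots> = z \<otimes> x" using eq rl_join_idem Utp_closed x z by simp
  finally show False using x ne Utp_tp_mult by simp
qed

lemma zero_cancellative_Utp: "zero_cancellative (R\<lparr>carrier := U \<union> {tp}\<rparr>) tp"
  unfolding zero_cancellative_def
proof (intro conjI ballI impI; (elim conjE)?)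
  show "monoid (R\<lparr>carrier := U \<union> {tp}\<rparr>)"
    using submonoid.submonoid_is_monoid[OF submonoid_Utp] monoid_axioms by blast
  show "is_zero (R\<lparr>carrier := U \<union> {tp}\<rparr>) tp"
    using Utp_tp_mult Utp_iff by (auto simp: is_zero_def)
next
  let ?S = "R\<lparr>carrier := U \<union> {tp}\<rparr>"
  fix x y z
  assume xyz: "x \<in> carrier ?S" "y \<in> carrier ?S" "z \<in> carrier ?S"
  then have mem: "x \<in> U \<union> {tp}" "y \<in> U \<union> {tp}" "z \<in> U \<union> {tp}"
    by simp_all
  show "y = z" if "x \<otimes>\<^bsub>?S\<^esub> y = x \<otimes>\<^bsub>?S\<^esub> z" "x \<otimes>\<^bsub>?S\<^esub> z \<noteq> tp"
    by (rule Utp_cancel_left[OF mem]) (use that in simp_all)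
  show "y = z" if "y \<otimes>\<^bsub>?S\<^esub> x = z \<otimes>\<^bsub>?S\<^esub> x" "z \<otimes>\<^bsub>?S\<^esub> x \<noteq> tp"
    by (rule Utp_cancel_right[OF mem]) (use that in simp_all)
qed

section \<open>Products of atoms that absorb \<open>\<top>\<close>\<close>

lemma mult_Zbt_le:
  assumes "x \<in> carrier R" "b \<in> Z \<union> {bt}"
  shows "rl_le R (x \<otimes> b) b" and "rl_le R (b \<otimes> x) b"
  using mult_mono_left[of x tp b] mult_mono_right[of x tp b] assms le_tp Zbt_closed
    Zbt_tp_mult Zbt_mult_tp by simp_all

lemma mult_Zbt_cases:
  assumes "x \<in> carrier R" "b \<in> Z \<union> {bt}"
  shows "x \<otimes> b = b \<or> x \<otimes> b = bt" and "b \<otimes> x = b \<or> b \<otimes> x = bt"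
proof -
  have "x \<otimes> b = b \<or> x \<otimes> b = bt" if "b \<in> Z"
    using le_atomD[OF mult_Zbt_le(1)] that assms Z_iff Zbt_closed by blast
  moreover have "b \<otimes> x = b \<or> b \<otimes> x = bt" if "b \<in> Z"
    using le_atomD[OF mult_Zbt_le(2)] that assms Z_iff Zbt_closed by blast
  ultimately show "x \<otimes> b = b \<or> x \<otimes> b = bt" "b \<otimes> x = b \<or> b \<otimes> x = bt"
    using assms mult_bt bt_mult by auto
qed

lemma Zbt_mult_distinct:
  assumes "x \<in> Z \<union> {bt}" "y \<in> Z \<union> {bt}" "x \<noteq> y"
  shows "x \<otimes> y = bt"
  using mult_Zbt_cases(1)[of x y] mult_Zbt_cases(2)[of y x] assms Zbt_closed by metis

lemma subsemigroup_Zbt: "subsemigroup (Z \<union> {bt}) R"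
proof -
  have "x \<otimes> y \<in> Z \<union> {bt}" if "x \<in> Z \<union> {bt}" "y \<in> Z \<union> {bt}" for x y
    using mult_Zbt_cases(1)[of x y] that Zbt_closed by auto
  then show ?thesis unfolding subsemigroup_def using Zbt_closed by blast
qed

lemma is_zero_Zbt: "is_zero (R\<lparr>carrier := Z \<union> {bt}\<rparr>) bt"
  using mult_bt bt_mult Zbt_closed by (auto simp: is_zero_def)

lemma Z_eq_join:
  assumes "x \<in> Z" "y \<in> Z" "z \<in> Z" "y \<noteq> z"
  shows "x = rl_join R (x \<otimes> y) (x \<otimes> z)"
  using mult_rl_join_right[of x y z] join_atoms[of y z] assms Z_iff atom_closed by simp

text \<open>A third element \<open>x\<close> of \<open>Z\<close> would be the join of \<open>xy = bt\<close> and \<open>xz = bt\<close>.\<close>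

lemma Z_no_three:
  assumes "x \<in> Z" "y \<in> Z" "z \<in> Z" "y \<noteq> z"
  shows "x = y \<or> x = z"
proof (rule ccontr)
  assume "\<not> ?thesis"
  then have "x \<otimes> y = bt" "x \<otimes> z = bt" using Zbt_mult_distinct assms by auto
  then have "x = bt" using Z_eq_join[OF assms] join_bt by simp
  then show False using assms Z_iff bt_notin by simp
qed

lemma Z_idem_if_two:
  assumes "x \<in> Z" "y \<in> Z" "x \<noteq> y"
  shows "x \<otimes> x = x"
proof -
  have "x = rl_join R (x \<otimes> x) (x \<otimes> y)" using Z_eq_join assms by blast
  also have "\<dots> = x \<otimes> x"
    using Zbt_mult_distinct[of x y] join_bt assms Z_iff atom_closed by simp
  finally show ?thesis by simp
qed

lemma Z_cases:
  obtains "Z = {}" | b where "Z = {b}" | x y where "Z = {x, y}" "x \<noteq> y"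
  using Z_no_three by blast

lemma finite_Zbt: "finite (Z \<union> {bt})"
  by (rule Z_cases) auto

lemma card_Zbt: "card (Z \<union> {bt}) \<le> 3"
proof (rule Z_cases)
  fix x y assume "Z = {x, y}"
  then have "Z \<union> {bt} = {x, y, bt}" by auto
  then show ?thesis using card_insert_le_m1[of 3 "{y, bt}" x] card_insert_le_m1[of 2 "{bt}" y]
    by simp
next
  fix b assume "Z = {b}"
  then have "Z \<union> {bt} = {b, bt}" by auto
  then show ?thesis using card_insert_le_m1[of 2 "{bt}" b] by simp
qed simp

text \<open>
  If \<open>x \<in> Z\<close> is not idempotent, then \<open>x\<close> is the only element of \<open>Z\<close>, because a second
  one would make it idempotent, and the only other value that its square can take is \<open>bt\<close>.
\<close>

lemma Zbt_idem_or_nilpotent: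
  "(\<forall>x\<in>Z \<union> {bt}. x \<otimes> x = x) \<or> (\<exists>b. b \<noteq> bt \<and> Z \<union> {bt} = {b, bt} \<and> b \<otimes> b = bt)"
proof (rule disjCI)
  assume not_nil: "\<not> (\<exists>b. b \<noteq> bt \<and> Z \<union> {bt} = {b, bt} \<and> b \<otimes> b = bt)"
  show "\<forall>x\<in>Z \<union> {bt}. x \<otimes> x = x"
  proof
    fix x assume x: "x \<in> Z \<union> {bt}"
    show "x \<otimes> x = x"
    proof (rule ccontr)
      assume non_idem: "x \<otimes> x \<noteq> x"
      have nil: "x \<otimes> x = bt" using mult_Zbt_cases(1) x non_idem Zbt_closed by blast
      then have "x \<noteq> bt" using non_idem by metis
      moreover have "Z \<union> {bt} = {x, bt}"
        using x \<open>x \<noteq> bt\<close> Z_idem_if_two non_idem by blast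
      ultimately show False using nil not_nil by blast
    qed
  qed
qed

text \<open>
  The product can only be \<open>b\<close> or \<open>bt\<close>, and multiplying it by \<open>tp\<close> on the side of \<open>a\<close>
  recovers \<open>b\<close>, which rules out \<open>bt\<close>.
\<close>

lemma U_mult_Z:
  assumes "a \<in> U" "b \<in> Z"
  shows "a \<otimes> b = b" and "b \<otimes> a = b"
proof -
  have a: "a \<in> carrier R" and b: "b \<in> carrier R" and "b \<noteq> bt"
    using assms U_iff Z_iff atom_closed bt_notin by auto
  have "tp \<otimes> (a \<otimes> b) = b"
    using m_assoc[OF tp_closed a b] Utp_tp_mult Zbt_tp_mult assms by simp
  then have "a \<otimes> b \<noteq> bt" using mult_bt \<open>b \<noteq> bt\<close> by auto
  then show "a \<otimes> b = b" using mult_Zbt_cases(1) a assms by blast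
  have "(b \<otimes> a) \<otimes> tp = b"
    using m_assoc[OF b a tp_closed] assms by (simp add: U_iff Z_iff)
  then have "b \<otimes> a \<noteq> bt" using bt_mult \<open>b \<noteq> bt\<close> by auto
  then show "b \<otimes> a = b" using mult_Zbt_cases(2) a assms by blast
qed

end

section \<open>The structure theorem\<close>

theorem theorem2p1:
  fixes R :: "('a, 'b) residuated_lattice_scheme" (structure)
    and X U Z :: "'a set" and bt tp :: 'a
  assumes "residuated_lattice R"
    and "based_on_M R X bt tp"
    and "U = {x \<in> carrier R - {bt, tp}. x \<otimes> tp = tp}"
    and "Z = {x \<in> carrier R - {bt, tp}. x \<otimes> tp = x}"
  shows
    "((\<forall>x\<in>carrier R. x \<otimes> tp = tp \<otimes> x) \<and>
      carrier R = U \<union> Z \<union> {bt, tp} \<and>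
      U \<inter> Z = {} \<and> U \<inter> {bt, tp} = {} \<and> Z \<inter> {bt, tp} = {}) \<and>
     (submonoid (U \<union> {tp}) R \<and>
      zero_cancellative (R\<lparr>carrier := U \<union> {tp}\<rparr>) tp) \<and>
     (subsemigroup (Z \<union> {bt}) R \<and>
      is_zero (R\<lparr>carrier := Z \<union> {bt}\<rparr>) bt \<and>
      finite (Z \<union> {bt}) \<and> card (Z \<union> {bt}) \<le> 3 \<and>
      (\<forall>x\<in>Z \<union> {bt}. \<forall>y\<in>Z \<union> {bt}. x \<noteq> y \<longrightarrow> x \<otimes> y = bt) \<and>
      ((\<forall>x\<in>Z \<union> {bt}. x \<otimes> x = x) \<or>
       (\<exists>b. b \<noteq> bt \<and> Z \<union> {bt} = {b, bt} \<and> b \<otimes> b = bt))) \<and>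
     (\<forall>a\<in>U. \<forall>b\<in>Z. a \<otimes> b = b \<and> b \<otimes> a = b)"
proof -
  interpret M: residuated_lattice_on_M R X bt tp
    using assms(1,2) by (simp add: residuated_lattice_on_M_def residuated_lattice_on_M_axioms_def)
  have U: "U = M.U" and Z: "Z = M.Z" using assms(3,4) by (simp_all add: M.U_def M.Z_def)
  have "U \<inter> {bt, tp} = {}" "Z \<inter> {bt, tp} = {}" using assms(3,4) by auto
  then show ?thesis
    unfolding U Z
    by (intro conjI ballI impI M.tp_central M.carrier_decomp M.U_Z_disjoint M.submonoid_Utp
      M.zero_cancellative_Utp M.subsemigroup_Zbt M.is_zero_Zbt M.finite_Zbt M.card_Zbt
      M.Zbt_mult_distinct M.Zbt_idem_or_nilpotent M.U_mult_Z) assumption+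
qed

end
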